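(* Let $\mathcal{T}_\alpha=((\mathcal{V},\mathcal{E},\alpha),\mathcal{F})$ be a magnetic triangulation. The exterior magnetic derivative operator satisfies the following gauge invariance: for every real function $f:\mathcal{V}\to\mathbb{R}$ and every $\varphi\in\mathcal{C}_{skew}(\mathcal{E})$, $$d^1_{\alpha+d^0f}(e^{if}.\varphi)=e^{if}.\,d^1_\alpha(\varphi).$$
   Context: A magnetic triangulation consists of an at most countable vertex set $\mathcal{V}$, a symmetric edge set $\mathcal{E}\subset\mathcal{V}\times\mathcal{V}$ without loops (the graph is assumed connected and locally finite), a magnetic potential $\alpha:\mathcal{E}\to\mathbb{R}$ with $\alpha(x,y)=-\alpha(y,x)$, and a set of faces $\mathcal{F}\subset\mathcal{V}^3$, stable under all permutations of the entries, such that $(x,y,z)\in\mathcal{F}$ implies $x,y,z$ pairwise adjacent. $\mathcal{C}_{skew}(\mathcal{E})$ is the set of $\varphi:\mathcal{E}\to\mathbb{C}$ with $\varphi(x,y)=-\varphi(y,x)$; $\mathcal{C}_{skew}(\mathcal{F})$ is the set of functions $\mathcal{F}\to\mathbb{C}$ alternating under permutations of the entries. Let $d^0f(x,y)=f(y)-f(x)$. The exterior magnetic derivative $d^1_\alpha:\mathcal{C}_{skew}(\mathcal{E})\to\mathcal{C}_{skew}(\mathcal{F})$ is $$d^1_\alpha\varphi(x,y,z)=e^{\frac i6(\alpha(x,z)+\alpha(y,z))}\varphi(x,y)+e^{\frac i6(\alpha(y,x)+\alpha(z,x))}\varphi(y,z)+e^{\frac i6(\alpha(z,y)+\alpha(x,y))}\varphi(z,x).$$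 The change of gauge given by a real function $f$ on $\mathcal{V}$ acts on $\varphi\in\mathcal{C}_{skew}(\mathcal{E})$ by $(e^{if}.\varphi)(x,y)=e^{\frac i2(f(x)+f(y))}\varphi(x,y)$ and on $\psi\in\mathcal{C}_{skew}(\mathcal{F})$ by $(e^{if}.\psi)(x,y,z)=e^{\frac i3(f(x)+f(y)+f(z))}\psi(x,y,z)$. *)

theory Defs
  imports Complex_Main "HOL-Library.FuncSet" "HOL-Library.Countable_Set"
begin

text \<open>
  A function on a carrier \<open>A\<close> is an extensional function in the sense of \<^theory>\<open>HOL-Library.FuncSet\<close>
  (with the value \<^const>\<open>undefined\<close> off \<open>A\<close>), so that equality of HOL functions is equality of
  functions on \<open>A\<close>. Edges are ordered pairs, and faces are ordered triples.
\<close>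

locale magnetic_graph =
  fixes V :: "'a set" and E :: "('a \<times> 'a) set" and \<alpha> :: "'a \<times> 'a \<Rightarrow> real"
  assumes countable_vertices: "countable V"
    and edges_subset: "E \<subseteq> V \<times> V"
    and sym_edges: "sym E"
    and no_loops: "irrefl E"
    and connected: "\<And>x y. x \<in> V \<Longrightarrow> y \<in> V \<Longrightarrow> (x, y) \<in> E\<^sup>*"
    and locally_finite: "\<And>x. x \<in> V \<Longrightarrow> finite {y. (x, y) \<in> E}"
    and potential: "\<alpha> \<in> E \<rightarrow>\<^sub>E UNIV"
    and potential_skew: "\<And>x y. (x, y) \<in> E \<Longrightarrow> \<alpha> (x, y) = - \<alpha> (y, x)"

locale magnetic_triangulation = magnetic_graph V E \<alpha>
  for V :: "'a set" and E :: "('a \<times> 'a) set" and \<alpha> :: "'a \<times> 'a \<Rightarrow> real" +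
  fixes F :: "('a \<times> 'a \<times> 'a) set"
  assumes faces_subset: "F \<subseteq> V \<times> V \<times> V"
    and faces_perm: "\<And>x y z. (x, y, z) \<in> F \<Longrightarrow>
      {(y, z, x), (z, x, y), (y, x, z), (x, z, y), (z, y, x)} \<subseteq> F"
    and faces_adjacent: "\<And>x y z. (x, y, z) \<in> F \<Longrightarrow> (x, y) \<in> E \<and> (y, z) \<in> E \<and> (z, x) \<in> E"

definition skew_edges :: "('a \<times> 'a) set \<Rightarrow> ('a \<times> 'a \<Rightarrow> complex) set" where
  "skew_edges E = {\<phi> \<in> E \<rightarrow>\<^sub>E UNIV. \<forall>x y. (x, y) \<in> E \<longrightarrow> \<phi> (x, y) = - \<phi> (y, x)}"

definition skew_faces :: "('a \<times> 'a \<times> 'a) set \<Rightarrow> ('a \<times> 'a \<times> 'a \<Rightarrow> complex) set" where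
  "skew_faces F = {\<psi> \<in> F \<rightarrow>\<^sub>E UNIV. \<forall>x y z. (x, y, z) \<in> F \<longrightarrow>
     \<psi> (y, z, x) = \<psi> (x, y, z) \<and> \<psi> (z, x, y) = \<psi> (x, y, z) \<and>
     \<psi> (y, x, z) = - \<psi> (x, y, z) \<and> \<psi> (x, z, y) = - \<psi> (x, y, z) \<and>
     \<psi> (z, y, x) = - \<psi> (x, y, z)}"

definition d0 :: "('a \<times> 'a) set \<Rightarrow> ('a \<Rightarrow> real) \<Rightarrow> 'a \<times> 'a \<Rightarrow> real" where
  "d0 E f = (\<lambda>(x, y)\<in>E. f y - f x)"

definition potential_add ::
    "('a \<times> 'a) set \<Rightarrow> ('a \<times> 'a \<Rightarrow> real) \<Rightarrow> ('a \<times> 'a \<Rightarrow> real) \<Rightarrow> 'a \<times> 'a \<Rightarrow> real" where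
  "potential_add E \<alpha> \<beta> = (\<lambda>e\<in>E. \<alpha> e + \<beta> e)"

definition d1 ::
    "('a \<times> 'a \<times> 'a) set \<Rightarrow> ('a \<times> 'a \<Rightarrow> real) \<Rightarrow> ('a \<times> 'a \<Rightarrow> complex) \<Rightarrow> 'a \<times> 'a \<times> 'a \<Rightarrow> complex" where
  "d1 F \<alpha> \<phi> = (\<lambda>(x, y, z)\<in>F.
     exp (\<i> / 6 * of_real (\<alpha> (x, z) + \<alpha> (y, z))) * \<phi> (x, y) +
     exp (\<i> / 6 * of_real (\<alpha> (y, x) + \<alpha> (z, x))) * \<phi> (y, z) +
     exp (\<i> / 6 * of_real (\<alpha> (z, y) + \<alpha> (x, y))) * \<phi> (z, x))"

definition gauge_edges ::
    "('a \<times> 'a) set \<Rightarrow> ('a \<Rightarrow> real) \<Rightarrow> ('a \<times> 'a \<Rightarrow> complex) \<Rightarrow> 'a \<times> 'a \<Rightarrow> complex" where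
  "gauge_edges E f \<phi> = (\<lambda>(x, y)\<in>E. exp (\<i> / 2 * of_real (f x + f y)) * \<phi> (x, y))"

definition gauge_faces ::
    "('a \<times> 'a \<times> 'a) set \<Rightarrow> ('a \<Rightarrow> real) \<Rightarrow> ('a \<times> 'a \<times> 'a \<Rightarrow> complex) \<Rightarrow> 'a \<times> 'a \<times> 'a \<Rightarrow> complex" where
  "gauge_faces F f \<psi> = (\<lambda>(x, y, z)\<in>F. exp (\<i> / 3 * of_real (f x + f y + f z)) * \<psi> (x, y, z))"

text \<open>The operators act between the intended spaces.\<close>

lemma gauge_edges_skew:
  assumes "sym E" "\<phi> \<in> skew_edges E"
  shows "gauge_edges E f \<phi> \<in> skew_edges E"
proof -
  have "gauge_edges E f \<phi> (x, y) = - gauge_edges E f \<phi> (y, x)" if xy: "(x, y) \<in> E" for x y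
  proof -
    have "\<phi> (x, y) = - \<phi> (y, x)"
      using assms(2) xy by (simp add: skew_edges_def)
    then show ?thesis
      using xy symD[OF assms(1) xy] by (simp add: gauge_edges_def add.commute)
  qed
  then show ?thesis
    by (simp add: skew_edges_def gauge_edges_def)
qed

lemma (in magnetic_triangulation) gauge_faces_skew:
  assumes "\<psi> \<in> skew_faces F"
  shows "gauge_faces F f \<psi> \<in> skew_faces F"
proof -
  have "gauge_faces F f \<psi> (y, z, x) = gauge_faces F f \<psi> (x, y, z) \<and>
     gauge_faces F f \<psi> (z, x, y) = gauge_faces F f \<psi> (x, y, z) \<and>
     gauge_faces F f \<psi> (y, x, z) = - gauge_faces F f \<psi> (x, y, z) \<and>
     gauge_faces F f \<psi> (x, z, y) = - gauge_faces F f \<psi> (x, y, z) \<and>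
     gauge_faces F f \<psi> (z, y, x) = - gauge_faces F f \<psi> (x, y, z)" if xyz: "(x, y, z) \<in> F" for x y z
  proof -
    have "\<psi> (y, z, x) = \<psi> (x, y, z) \<and> \<psi> (z, x, y) = \<psi> (x, y, z) \<and>
      \<psi> (y, x, z) = - \<psi> (x, y, z) \<and> \<psi> (x, z, y) = - \<psi> (x, y, z) \<and> \<psi> (z, y, x) = - \<psi> (x, y, z)"
      using assms xyz by (simp add: skew_faces_def)
    then show ?thesis
      using xyz faces_perm[OF xyz] by (simp add: gauge_faces_def add_ac)
  qed
  then show ?thesis
    by (simp add: skew_faces_def gauge_faces_def)
qed

lemma (in magnetic_triangulation) d1_skew:
  assumes "\<phi> \<in> skew_edges E"
  shows "d1 F \<alpha> \<phi> \<in> skew_faces F"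
proof -
  have "d1 F \<alpha> \<phi> (y, z, x) = d1 F \<alpha> \<phi> (x, y, z) \<and>
     d1 F \<alpha> \<phi> (z, x, y) = d1 F \<alpha> \<phi> (x, y, z) \<and>
     d1 F \<alpha> \<phi> (y, x, z) = - d1 F \<alpha> \<phi> (x, y, z) \<and>
     d1 F \<alpha> \<phi> (x, z, y) = - d1 F \<alpha> \<phi> (x, y, z) \<and>
     d1 F \<alpha> \<phi> (z, y, x) = - d1 F \<alpha> \<phi> (x, y, z)" if xyz: "(x, y, z) \<in> F" for x y z
  proof -
    have skew: "\<phi> (y, x) = - \<phi> (x, y)" "\<phi> (z, y) = - \<phi> (y, z)" "\<phi> (x, z) = - \<phi> (z, x)"
      using faces_adjacent[OF xyz] assms by (simp_all add: skew_edges_def)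
    show ?thesis
      using xyz faces_perm[OF xyz] by (simp add: d1_def skew add_ac)
  qed
  then show ?thesis
    by (simp add: skew_faces_def d1_def)
qed

lemma (in magnetic_triangulation) gauge_potential:
  "magnetic_triangulation V E (potential_add E \<alpha> (d0 E f)) F"
proof unfold_locales
  show "potential_add E \<alpha> (d0 E f) \<in> E \<rightarrow>\<^sub>E UNIV"
    by (simp add: potential_add_def)
  show "potential_add E \<alpha> (d0 E f) (x, y) = - potential_add E \<alpha> (d0 E f) (y, x)"
    if "(x, y) \<in> E" for x y
    using that symD[OF sym_edges that] potential_skew[OF that]
    by (simp add: potential_add_def d0_def)
qed (fact countable_vertices edges_subset sym_edges no_loops connected locally_finite faces_subset faces_perm faces_adjacent | assumption)+

end

theory Submission
  imports Defs
begin

text \<open>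
  In each of the three terms of the derivative, with edge \<open>(x, y)\<close> and opposite vertex \<open>z\<close>, the
  phases of \<open>f\<close> from the potential and from the gauge change on edges combine to the symmetric
  phase of the face: \<open>(2 f z - f x - f y) / 6 + (f x + f y) / 2 = (f x + f y + f z) / 3\<close>.
\<close>

lemma gauge_phase:
  fixes a b p q r :: real and w :: complex
  shows "exp (\<i> / 6 * of_real ((a + (r - p)) + (b + (r - q)))) * (exp (\<i> / 2 * of_real (p + q)) * w) =
    exp (\<i> / 3 * of_real (p + q + r)) * (exp (\<i> / 6 * of_real (a + b)) * w)"
proof -
  have "\<i> / 6 * of_real ((a + (r - p)) + (b + (r - q))) + \<i> / 2 * of_real (p + q) =
      \<i> / 3 * of_real (p + q + r) + \<i> / 6 * of_real (a + b)"
    by (simp add: field_simps)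
  then show ?thesis
    by (metis exp_add mult.assoc)
qed

theorem mainTheorem6:
  fixes V :: "'a set" and E :: "('a \<times> 'a) set" and \<alpha> :: "'a \<times> 'a \<Rightarrow> real"
    and F :: "('a \<times> 'a \<times> 'a) set" and f :: "'a \<Rightarrow> real" and \<phi> :: "'a \<times> 'a \<Rightarrow> complex"
  assumes "magnetic_triangulation V E \<alpha> F"
    and "f \<in> V \<rightarrow>\<^sub>E UNIV"
    and "\<phi> \<in> skew_edges E"
  shows "d1 F (potential_add E \<alpha> (d0 E f)) (gauge_edges E f \<phi>) = gauge_faces F f (d1 F \<alpha> \<phi>)"
proof -
  interpret magnetic_triangulation V E \<alpha> F
    by (fact assms(1))
  have "d1 F (potential_add E \<alpha> (d0 E f)) (gauge_edges E f \<phi>) (x, y, z) =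
      gauge_faces F f (d1 F \<alpha> \<phi>) (x, y, z)" for x y z
  proof (cases "(x, y, z) \<in> F")
    case True
    have edges: "(x, y) \<in> E" "(y, z) \<in> E" "(z, x) \<in> E"
      using faces_adjacent[OF True] by auto
    \<comment> \<open>The three terms evaluate the potential on all six orientations of the sides;
      \<open>potential_add\<close> and \<open>d0\<close> give the intended values only on
      \<open>E\<close>.\<close>
    then have "(y, x) \<in> E" "(z, y) \<in> E" "(x, z) \<in> E"
      using sym_edges by (auto dest: symD)
    \<comment> \<open>In each term the sum of the \<open>f\<close> values lists the endpoints of the
      edge first and the opposite vertex last, so that \<open>gauge_phase\<close>, read from right
      to left, applies with \<open>r\<close> at that vertex.\<close>
    with edges have "d1 F (potential_add E \<alpha> (d0 E f)) (gauge_edges E f \<phi>) (x, y, z) =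
        exp (\<i> / 3 * of_real (f x + f y + f z)) * (exp (\<i> / 6 * of_real (\<alpha> (x, z) + \<alpha> (y, z))) * \<phi> (x, y)) +
        exp (\<i> / 3 * of_real (f y + f z + f x)) * (exp (\<i> / 6 * of_real (\<alpha> (y, x) + \<alpha> (z, x))) * \<phi> (y, z)) +
        exp (\<i> / 3 * of_real (f z + f x + f y)) * (exp (\<i> / 6 * of_real (\<alpha> (z, y) + \<alpha> (x, y))) * \<phi> (z, x))"
      unfolding gauge_phase[symmetric]
      using True by (simp add: d1_def potential_add_def d0_def gauge_edges_def add_ac)
    \<comment> \<open>The three face phases agree up to the order of summation, so they factor
      out.\<close>
    also have "\<dots> = gauge_faces F f (d1 F \<alpha> \<phi>) (x, y, z)"
      using True by (simp add: gauge_faces_def d1_def distrib_left add_ac)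
    finally show ?thesis .
  next
    \<comment> \<open>Off \<open>F\<close> both sides are \<open>undefined\<close> by
      extensionality.\<close>
    case False
    then show ?thesis
      by (simp add: d1_def gauge_faces_def)
  qed
  then show ?thesis
    by (simp add: fun_eq_iff)
qed

end
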